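(* Let $\rho,\omega,\tau>0$, let $S\in\mathbb{R}^{n\times n}$ be symmetric positive definite, and let $f:\mathbb{R}^n\to\mathbb{R}$, $c:\mathbb{R}^n\to\mathbb{R}^m$ be bounded and twice Lipschitz-continuously differentiable. Choose an arbitrary initial guess $\mathbf{x}_0\in\Omega$ and consider the iterates $\{\mathbf{x}_k\}_{k\in\mathbb{N}_0}\subset\{\xi\in\Omega:\phi(\xi)\le\phi(\mathbf{x}_0)\}$ of the PPD-IPM algorithm (described in the context). Define $\mathbf{x}_\infty:=\lim_{k\to\infty}\mathbf{x}_k$. Then $$\|\nabla\phi(\mathbf{x}_\infty)\|_2=0 .$$ That is, from every initial guess the iterates converge to a stationary point of $\phi$.
   Context: $\mathbf{1}\in\mathbb{R}^n$ is the vector of ones; $\log$ acts componentwise. $\nabla c(\mathbf{x})\in\mathbb{R}^{n\times m}$ is the transposed Jacobian of $c$. $\Omega:=\{\xi\in\mathbb{R}^n:\|\xi\|_\infty<1\}$. The penalty-barrier function on $\Omega$ is $$\phi(\mathbf{x}):=f(\mathbf{x})+\frac{\rho}{2}\mathbf{x}^{T}S\mathbf{x}+\frac{1}{2\omega}\|c(\mathbf{x})\|_2^2-\tau\,\mathbf{1}^{T}\big(\log(\mathbf{1}+\mathbf{x})+\log(\mathbf{1}-\mathbf{x})\big).$$ The Lagrangian is $\mathcal{L}(\mathbf{x},\lambda):=f(\mathbf{x})-\lambda^{T}c(\mathbf{x})$. PPD-IPM algorithm (considered without its stopping test $\|\nabla\phi(\mathbf{x}_k)\|_2\le\mathrm{tol}$,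 so that it yields an infinite sequence). Given $\mathbf{x}_k\in\Omega$: 1. Set $\lambda_k:=-\frac1\omega c(\mathbf{x}_k)$ and $H_k:=\nabla^2_{\mathbf{x}\mathbf{x}}\mathcal{L}(\mathbf{x}_k,\lambda_k)$. 2. Choose an approximation $\widetilde H_k\approx H_k$ such that $\widetilde M_k:=\widetilde H_k+\frac1\omega\nabla c(\mathbf{x}_k)\nabla c(\mathbf{x}_k)^{T}$ is symmetric positive semi-definite. 3. Set $Q_k:=\widetilde H_k+\rho S$, $A_k:=\nabla c(\mathbf{x}_k)^{T}$, $\mathbf{c}_k:=\nabla f(\mathbf{x}_k)-\widetilde H_k\mathbf{x}_k$, $\mathbf{b}_k:=-c(\mathbf{x}_k)+A_k\mathbf{x}_k$, and $$q_k(\mathbf{x}):=\tfrac12\mathbf{x}^{T}Q_k\mathbf{x}+\mathbf{c}_k^{T}\mathbf{x}+\frac{1}{2\omega}\|A_k\mathbf{x}-\mathbf{b}_k\|_2^2-\tau\,\mathbf{1}^{T}\big(\log(\mathbf{1}+\mathbf{x})+\log(\mathbf{1}-\mathbf{x})\big).$$ (This function is strictly convex and $\nabla q_k(\mathbf{x}_k)=\nabla\phi(\mathbf{x}_k)$.) 4. Let $\hat{\mathbf{x}}_k$ be the minimizer of $q_k$ over $\overline\Omega$ (it lies in $\Omega$), and $\mathbf{v}_k:=\hat{\mathbf{x}}_k-\mathbf{x}_k$. 5. Let $\alpha_k:=\operatorname{argmin}_{\alpha\in\mathbb{R}^+}\phi(\mathbf{x}_k+\alpha\mathbf{v}_k)$,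 the minimization being along the line inside $\Omega$, and set $\mathbf{x}_{k+1}:=\mathbf{x}_k+\alpha_k\mathbf{v}_k$.
   Formalization: The approximations of H_k are required to have uniformly bounded errors, and the limit of the iterates is assumed to exist for the stationarity claim (it can fail to exist); without it, only that the distance of the iterates to the set of stationary points tends to 0 is shown. *)

theory Defs
  imports "HOL-Analysis.Analysis"
begin

text \<open>Gradients are column vectors and \<open>hessian\<close> is the Jacobian of the gradient. Both are only
  meaningful at points where the derivatives exist.\<close>

definition grad :: "(real^'n \<Rightarrow> real) \<Rightarrow> real^'n \<Rightarrow> real^'n" where
  "grad g x = (THE D. GDERIV g x :> D)"

definition hessian :: "(real^'n \<Rightarrow> real) \<Rightarrow> real^'n \<Rightarrow> real^'n^'n" where
  "hessian g x = jacobian (grad g) (at x)"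

definition transposed_jacobian :: "(real^'n \<Rightarrow> real^'m) \<Rightarrow> real^'n \<Rightarrow> real^'m^'n" where
  "transposed_jacobian c x = transpose (jacobian c (at x))"

definition twice_lipschitz_differentiable :: "(real^'n \<Rightarrow> real) \<Rightarrow> bool" where
  "twice_lipschitz_differentiable g \<longleftrightarrow>
     (\<forall>x. g differentiable (at x)) \<and> (\<forall>x. grad g differentiable (at x)) \<and>
     (\<exists>L. L-lipschitz_on UNIV (hessian g))"

definition sym_pos_def :: "real^'n^'n \<Rightarrow> bool" where
  "sym_pos_def M \<longleftrightarrow> transpose M = M \<and> (\<forall>x. x \<noteq> 0 \<longrightarrow> 0 < x \<bullet> (M *v x))"

definition sym_pos_semidef :: "real^'n^'n \<Rightarrow> bool" where
  "sym_pos_semidef M \<longleftrightarrow> transpose M = M \<and> (\<forall>x. 0 \<le> x \<bullet> (M *v x))"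

definition Omega :: "(real^'n) set" where
  "Omega = {\<xi>. infnorm \<xi> < 1}"

text \<open>As \<open>ln\<close> is total, this and the functions built from it are only meaningful on \<open>Omega\<close>.\<close>

definition log_terms :: "real^'n \<Rightarrow> real" where
  "log_terms x = (\<Sum>i\<in>UNIV. ln (1 + x $ i) + ln (1 - x $ i))"

definition phi ::
  "real \<Rightarrow> real \<Rightarrow> real \<Rightarrow> real^'n^'n \<Rightarrow> (real^'n \<Rightarrow> real) \<Rightarrow> (real^'n \<Rightarrow> real^'m) \<Rightarrow> real^'n \<Rightarrow> real" where
  "phi \<rho> \<omega> \<tau> S f c x =
     f x + \<rho> / 2 * (x \<bullet> (S *v x)) + 1 / (2 * \<omega>) * (norm (c x))\<^sup>2 - \<tau> * log_terms x"

definition lagrangian ::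
  "(real^'n \<Rightarrow> real) \<Rightarrow> (real^'n \<Rightarrow> real^'m) \<Rightarrow> real^'n \<Rightarrow> real^'m \<Rightarrow> real" where
  "lagrangian f c x l = f x - l \<bullet> c x"

definition exact_hessian ::
  "real \<Rightarrow> (real^'n \<Rightarrow> real) \<Rightarrow> (real^'n \<Rightarrow> real^'m) \<Rightarrow> real^'n \<Rightarrow> real^'n^'n" where
  "exact_hessian \<omega> f c xk =
     (let lk = - (1 / \<omega>) *\<^sub>R c xk in hessian (\<lambda>x. lagrangian f c x lk) xk)"

definition model_matrix ::
  "real \<Rightarrow> (real^'n \<Rightarrow> real^'m) \<Rightarrow> real^'n \<Rightarrow> real^'n^'n \<Rightarrow> real^'n^'n" where
  "model_matrix \<omega> c xk Hk =
     Hk + (1 / \<omega>) *\<^sub>R (transposed_jacobian c xk ** transpose (transposed_jacobian c xk))"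

definition model_q ::
  "real \<Rightarrow> real \<Rightarrow> real \<Rightarrow> real^'n^'n \<Rightarrow> (real^'n \<Rightarrow> real) \<Rightarrow> (real^'n \<Rightarrow> real^'m) \<Rightarrow>
   real^'n \<Rightarrow> real^'n^'n \<Rightarrow> real^'n \<Rightarrow> real" where
  "model_q \<rho> \<omega> \<tau> S f c xk Hk x =
     (let Q = Hk + \<rho> *\<^sub>R S;
          A = transpose (transposed_jacobian c xk);
          ck = grad f xk - Hk *v xk;
          bk = - c xk + A *v xk
      in 1 / 2 * (x \<bullet> (Q *v x)) + ck \<bullet> x
           + 1 / (2 * \<omega>) * (norm (A *v x - bk))\<^sup>2 - \<tau> * log_terms x)"

text \<open>One iteration from \<open>xk\<close> to \<open>xk'\<close> with \<open>Hk\<close> as the approximate Hessian. On the boundary of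
  \<open>Omega\<close> the barrier is infinite (whereas \<open>ln 0 = 0\<close> in HOL), so minimizing the model
  over the closure of \<open>Omega\<close> means minimizing it over \<open>Omega\<close>. The line search is a global
  minimization over the part of the ray that lies in \<open>Omega\<close>; if minimizers are not unique, any
  one may be taken.\<close>

definition ppd_ipm_step ::
  "real \<Rightarrow> real \<Rightarrow> real \<Rightarrow> real^'n^'n \<Rightarrow> (real^'n \<Rightarrow> real) \<Rightarrow> (real^'n \<Rightarrow> real^'m) \<Rightarrow>
   real^'n \<Rightarrow> real^'n^'n \<Rightarrow> real^'n \<Rightarrow> bool" where
  "ppd_ipm_step \<rho> \<omega> \<tau> S f c xk Hk xk' \<longleftrightarrow>
     sym_pos_semidef (model_matrix \<omega> c xk Hk) \<and>
     (\<exists>xhat v \<alpha>.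
        is_arg_min (model_q \<rho> \<omega> \<tau> S f c xk Hk) (\<lambda>y. y \<in> Omega) xhat \<and>
        v = xhat - xk \<and>
        is_arg_min (\<lambda>a. phi \<rho> \<omega> \<tau> S f c (xk + a *\<^sub>R v))
          (\<lambda>a. 0 \<le> a \<and> xk + a *\<^sub>R v \<in> Omega) \<alpha> \<and>
        xk' = xk + \<alpha> *\<^sub>R v)"

text \<open>The sequence \<open>H\<close> records the chosen approximations of the exact Hessians. That they are
  approximations is expressed by a bound on the errors which is uniform in \<open>k\<close> but
  otherwise arbitrary. Without any bound, the steps can be made asymptotically orthogonal to the
  gradient, and the iterates can then converge to a non-stationary point.\<close>

definition ppd_ipm_iterates ::
  "real \<Rightarrow> real \<Rightarrow> real \<Rightarrow> real^'n^'n \<Rightarrow> (real^'n \<Rightarrow> real) \<Rightarrow> (real^'n \<Rightarrow> real^'m) \<Rightarrow>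
   (nat \<Rightarrow> real^'n^'n) \<Rightarrow> (nat \<Rightarrow> real^'n) \<Rightarrow> bool" where
  "ppd_ipm_iterates \<rho> \<omega> \<tau> S f c H x \<longleftrightarrow>
     x 0 \<in> Omega \<and>
     (\<forall>k. ppd_ipm_step \<rho> \<omega> \<tau> S f c (x k) (H k) (x (Suc k))) \<and>
     bounded (range (\<lambda>k. H k - exact_hessian \<omega> f c (x k)))"

end

theory Submission
  imports Defs
begin

text \<open>
  Write \<open>g\<close> for the gradient of \<open>\<phi>\<close>, and \<open>v\<^sub>k\<close> for the step from the iterate \<open>x\<^sub>k\<close> to the
  minimizer of the model \<open>q\<^sub>k\<close>. The heart of the matter is that the search directions are uniformly
  gradient related: there is a constant \<open>t > 0\<close> with
  \<open>g(x\<^sub>k) \<bullet> v\<^sub>k \<le> - (t/2) \<parallel>g(x\<^sub>k)\<parallel>\<^sup>2\<close> for all \<open>k\<close> (\<open>model_minimizer_descent\<close>). The model is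
  convex and has gradient \<open>g(x\<^sub>k)\<close> at \<open>x\<^sub>k\<close>, so it decreases by at most \<open>- g(x\<^sub>k) \<bullet> v\<^sub>k\<close>
  on the way to its minimizer. On the other hand the minimizer is at least as good as the
  point \<open>x\<^sub>k - t g(x\<^sub>k)\<close>, where the model is smaller than at \<open>x\<^sub>k\<close> by at least
  \<open>(t/2) \<parallel>g(x\<^sub>k)\<parallel>\<^sup>2\<close> once \<open>t\<close> is small compared with the inverse of the curvature of \<open>q\<^sub>k\<close> near
  \<open>x\<^sub>k\<close>.

  That \<open>t\<close> can be chosen independently of \<open>k\<close> is a compactness argument. The line search never
  increases \<open>\<phi>\<close>, and since \<open>f\<close> is bounded below, the barrier confines every sublevel set of
  \<open>\<phi>\<close> to a compact cube inside \<open>Omega\<close> (\<open>phi_sublevel_subset_cube\<close>). On this cube all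
  derivatives are bounded, hence so are the exact Hessians and, the errors being bounded, the
  matrices of the models (\<open>bounded_model_matrices\<close>).

  An exact line search along such directions drives the gradient to zero: as \<open>g\<close> is uniformly
  continuous on a compact cube, an iterate with \<open>\<parallel>g(x\<^sub>k)\<parallel> \<ge> \<epsilon>\<close> is followed by a decrease of \<open>\<phi>\<close> of at least
  a positive amount depending only on \<open>\<epsilon>\<close>, which can happen only finitely often
  (\<open>exact_line_search_gradient_tendsto_zero\<close>). By continuity of \<open>g\<close> every limit point of the
  iterates is then stationary, and by compactness the iterates approach the set of stationary
  points (\<open>eventually_close_to_zero_set\<close>).
\<close>

(* The default simplification turns a transposed matrix applied to a vector into a row vector
   product, which hides the quadratic forms used below. *)
declare transpose_matrix_vector [simp del]

section \<open>Gradients and matrices\<close>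

lemma grad_eqI:
  assumes "GDERIV g x :> D"
  shows "grad g x = D"
  unfolding grad_def
proof (rule the_equality)
  show "GDERIV g x :> D"
    by (rule assms)
  fix E assume "GDERIV g x :> E"
  then have "(\<lambda>h. h \<bullet> E) = (\<lambda>h. h \<bullet> D)"
    using assms has_derivative_unique unfolding gderiv_def by blast
  then show "E = D"
    by (metis vector_eq_ldot)
qed

lemma GDERIV_grad:
  fixes g :: "real^'n \<Rightarrow> real"
  assumes "g differentiable (at x)"
  shows "GDERIV g x :> grad g x"
proof -
  obtain g' where g': "(g has_derivative g') (at x)"
    using assms by (auto simp: differentiable_def)
  interpret bounded_linear g'
    using g' by (rule has_derivative_bounded_linear)
  have "linear g'"
    by (rule linear_axioms)
  then have "g' = (\<lambda>h. h \<bullet> adjoint g' 1)"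
    using adjoint_works[of g'] by (auto simp: fun_eq_iff)
  then have "GDERIV g x :> adjoint g' 1"
    using g' unfolding gderiv_def by simp
  then show ?thesis
    using grad_eqI by metis
qed

lemma GDERIV_sum:
  assumes "\<And>i. i \<in> I \<Longrightarrow> GDERIV (g i) x :> D i"
  shows "GDERIV (\<lambda>y. \<Sum>i\<in>I. g i y) x :> (\<Sum>i\<in>I. D i)"
  using assms unfolding gderiv_def inner_sum_right by (rule has_derivative_sum)

lemma norm_matrix_vector_mult_le:
  fixes A :: "real^'n^'m"
  shows "norm (A *v d) \<le> norm A * norm d"
proof (rule power2_le_imp_le)
  have "(norm (A *v d))\<^sup>2 = (\<Sum>i\<in>UNIV. (A $ i \<bullet> d)\<^sup>2)"
    by (simp add: norm_vec_def L2_set_def sum_nonneg matrix_vector_mul_component)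
  also have "\<dots> \<le> (\<Sum>i\<in>UNIV. (norm (A $ i))\<^sup>2 * (norm d)\<^sup>2)"
    by (intro sum_mono) (metis Cauchy_Schwarz_ineq2 abs_ge_zero power2_abs power_mono power_mult_distrib)
  also have "\<dots> = (norm A * norm d)\<^sup>2"
    by (simp add: norm_vec_def[of A] L2_set_def sum_nonneg power_mult_distrib sum_distrib_right)
  finally show "(norm (A *v d))\<^sup>2 \<le> (norm A * norm d)\<^sup>2" .
qed simp

lemma inner_symmetric_matrix:
  fixes M :: "real^'n^'n"
  assumes "transpose M = M"
  shows "x \<bullet> (M *v y) = y \<bullet> (M *v x)"
  by (metis assms dot_lmul_matrix inner_commute transpose_matrix_vector)

lemma quadratic_form_add:
  fixes M :: "real^'n^'n"
  assumes "transpose M = M"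
  shows "(x + d) \<bullet> (M *v (x + d)) = x \<bullet> (M *v x) + 2 * (d \<bullet> (M *v x)) + d \<bullet> (M *v d)"
  using inner_symmetric_matrix[OF assms, of x d]
  by (simp add: matrix_vector_right_distrib inner_add_left inner_add_right)

lemma GDERIV_quadratic_form:
  fixes M :: "real^'n^'n"
  assumes "transpose M = M"
  shows "GDERIV (\<lambda>y. y \<bullet> (M *v y)) x :> 2 *\<^sub>R (M *v x)"
proof -
  have M: "((\<lambda>y. M *v y) has_derivative (\<lambda>h. M *v h)) (at x)"
    by (rule bounded_linear.has_derivative[OF matrix_vector_mul_bounded_linear has_derivative_ident])
  show ?thesis
    unfolding gderiv_def
    by (rule has_derivative_eq_rhs[OF has_derivative_inner[OF has_derivative_ident M]])
       (auto simp: fun_eq_iff inner_symmetric_matrix[OF assms, of x])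
qed

lemma continuous_on_grad:
  assumes "twice_lipschitz_differentiable g"
  shows "continuous_on A (grad g)"
  using assms unfolding twice_lipschitz_differentiable_def
  by (intro continuous_at_imp_continuous_on) (auto intro: differentiable_imp_continuous_within)

lemma continuous_on_hessian:
  assumes "twice_lipschitz_differentiable g"
  shows "continuous_on A (hessian g)"
  using assms lipschitz_on_continuous_on continuous_on_subset
  unfolding twice_lipschitz_differentiable_def by blast

section \<open>The logarithmic barrier\<close>

lemma mem_Omega_iff: "x \<in> Omega \<longleftrightarrow> (\<forall>i. \<bar>x $ i\<bar> < 1)"
proof
  assume "x \<in> Omega"
  then show "\<forall>i. \<bar>x $ i\<bar> < 1"
    unfolding Omega_def using component_le_infnorm_cart[of x] by (auto intro: le_less_trans)
next
  assume *: "\<forall>i. \<bar>x $ i\<bar> < 1"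
  have "{\<bar>x $ i\<bar> |i. i \<in> UNIV} = (\<lambda>i. \<bar>x $ i\<bar>) ` UNIV"
    by auto
  then show "x \<in> Omega"
    unfolding Omega_def mem_Collect_eq infnorm_cart \<open>{\<bar>x $ i\<bar> |i. i \<in> UNIV} = _\<close> using *
    by (subst finite_imp_Sup_less) auto
qed

text \<open>The barrier confines the iterates to such cubes, with \<open>r < 1\<close>; unlike \<open>Omega\<close> they are
  compact.\<close>

definition cube :: "real \<Rightarrow> (real^'n) set" where
  "cube r = {x. \<forall>i. \<bar>x $ i\<bar> \<le> r}"

lemma compact_cube: "compact (cube r :: (real^'n) set)"
proof -
  have "(cube r :: (real^'n) set) = cbox (\<chi> i. - r) (\<chi> i. r)"
    by (auto simp: cube_def mem_box_cart abs_le_iff minus_le_iff)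
  then show ?thesis
    by (simp add: compact_cbox)
qed

lemma cube_subset_Omega: "r < 1 \<Longrightarrow> cube r \<subseteq> Omega"
  by (auto simp: cube_def mem_Omega_iff) (meson le_less_trans)

lemma cube_mono: "r \<le> s \<Longrightarrow> cube r \<subseteq> cube s"
  by (auto simp: cube_def intro: order_trans)

lemma cube_add:
  assumes "x \<in> cube r" "norm d \<le> s"
  shows "x + d \<in> cube (r + s)"
proof -
  have "\<bar>x $ i + d $ i\<bar> \<le> r + s" for i
    using abs_triangle_ineq[of "x $ i" "d $ i"] assms(1) norm_bound_component_le_cart[OF assms(2), of i]
    by (auto simp: cube_def dest!: spec[of _ i])
  then show ?thesis
    by (simp add: cube_def)
qed

definition log_terms_grad :: "real^'n \<Rightarrow> real^'n" where
  "log_terms_grad x = (\<chi> i. 1 / (1 + x $ i) - 1 / (1 - x $ i))"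

lemma ln_diff_le:
  fixes a b :: real
  assumes "0 < a" "0 < b"
  shows "ln b - ln a \<le> (b - a) / a"
  using ln_le_minus_one[of "b / a"] assms by (simp add: ln_div field_simps)

text \<open>Concavity of the logarithm, coordinate by coordinate. It gives the tangent plane bound
  for the model.\<close>

lemma log_terms_supergradient:
  assumes "x \<in> Omega" "y \<in> Omega"
  shows "log_terms y - log_terms x \<le> (y - x) \<bullet> log_terms_grad x"
proof -
  have "ln (1 + y $ i) + ln (1 - y $ i) - (ln (1 + x $ i) + ln (1 - x $ i))
      \<le> (y - x) $ i * (log_terms_grad x $ i)" for i
  proof -
    have "\<bar>x $ i\<bar> < 1" "\<bar>y $ i\<bar> < 1"
      using assms by (auto simp: mem_Omega_iff)
    then have "ln (1 + y $ i) - ln (1 + x $ i) \<le> ((1 + y $ i) - (1 + x $ i)) / (1 + x $ i)"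
      "ln (1 - y $ i) - ln (1 - x $ i) \<le> ((1 - y $ i) - (1 - x $ i)) / (1 - x $ i)"
      by (intro ln_diff_le; simp)+
    then show ?thesis
      by (simp add: log_terms_grad_def right_diff_distrib diff_divide_distrib algebra_simps)
  qed
  then show ?thesis
    by (auto simp: log_terms_def inner_vec_def simp flip: sum_subtractf intro!: sum_mono)
qed

text \<open>Away from the faces of the cube the denominators of the barrier gradient are at least
  \<open>\<delta>\<close>, so each of its two reciprocals is Lipschitz with constant \<open>1 / \<delta>\<^sup>2\<close>.\<close>

lemma log_terms_grad_lipschitz:
  fixes x y :: "real^'n"
  assumes "x \<in> cube (1 - \<delta>)" "y \<in> cube (1 - \<delta>)" "0 < \<delta>"
  shows "(x - y) \<bullet> (log_terms_grad y - log_terms_grad x) \<le> 2 / \<delta>\<^sup>2 * (norm (x - y))\<^sup>2"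
proof -
  have recip: "(a - b) * (1 / b - 1 / a) \<le> (a - b)\<^sup>2 / \<delta>\<^sup>2" if "\<delta> \<le> a" "\<delta> \<le> b" for a b :: real
  proof -
    have "(a - b) * (1 / b - 1 / a) = (a - b)\<^sup>2 / (a * b)"
      using that assms(3) by (simp add: field_simps power2_eq_square)
    also have "\<dots> \<le> (a - b)\<^sup>2 / \<delta>\<^sup>2"
      using that assms(3) by (intro divide_left_mono) (auto simp: power2_eq_square intro!: mult_mono)
    finally show ?thesis .
  qed
  have "(x - y) $ i * (log_terms_grad y - log_terms_grad x) $ i \<le> 2 / \<delta>\<^sup>2 * ((x - y) $ i)\<^sup>2" for i
  proof -
    have "\<bar>x $ i\<bar> \<le> 1 - \<delta>" "\<bar>y $ i\<bar> \<le> 1 - \<delta>"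
      using assms by (auto simp: cube_def)
    then have "((1 + x $ i) - (1 + y $ i)) * (1 / (1 + y $ i) - 1 / (1 + x $ i))
        + ((1 - x $ i) - (1 - y $ i)) * (1 / (1 - y $ i) - 1 / (1 - x $ i))
        \<le> ((1 + x $ i) - (1 + y $ i))\<^sup>2 / \<delta>\<^sup>2 + ((1 - x $ i) - (1 - y $ i))\<^sup>2 / \<delta>\<^sup>2"
      by (intro add_mono recip) auto
    moreover have "(x $ i - y $ i)\<^sup>2 = (y $ i - x $ i)\<^sup>2"
      by (rule power2_commute)
    moreover have "(a - b) * ((p - q) - (p' - q'))
        = ((1 + a) - (1 + b)) * (p - p') + ((1 - a) - (1 - b)) * (q - q')" for a b p q p' q' :: real
      by algebra
    ultimately show ?thesis
      by (simp add: log_terms_grad_def)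
  qed
  then have "(x - y) \<bullet> (log_terms_grad y - log_terms_grad x) \<le> (\<Sum>i\<in>UNIV. 2 / \<delta>\<^sup>2 * ((x - y) $ i)\<^sup>2)"
    unfolding inner_vec_def by (auto intro!: sum_mono)
  also have "\<dots> = 2 / \<delta>\<^sup>2 * (norm (x - y))\<^sup>2"
    by (simp add: norm_vec_def L2_set_def sum_nonneg sum_distrib_left)
  finally show ?thesis .
qed

text \<open>The converse of the tangent plane bound up to a quadratic error. It follows from that bound with the roles of the two points exchanged, because the gradient is Lipschitz.\<close>

lemma log_terms_lower_model:
  fixes x d :: "real^'n"
  assumes "x \<in> cube (1 - \<delta>)" "x + d \<in> cube (1 - \<delta>)" "0 < \<delta>"
  shows "d \<bullet> log_terms_grad x - 2 / \<delta>\<^sup>2 * (norm d)\<^sup>2 \<le> log_terms (x + d) - log_terms x"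
proof -
  have "x \<in> Omega" "x + d \<in> Omega"
    using assms cube_subset_Omega[of "1 - \<delta>"] by auto
  then have "log_terms x - log_terms (x + d) \<le> (- d) \<bullet> log_terms_grad (x + d)"
    using log_terms_supergradient[of "x + d" x] by simp
  moreover have "d \<bullet> (log_terms_grad x - log_terms_grad (x + d)) \<le> 2 / \<delta>\<^sup>2 * (norm d)\<^sup>2"
    using log_terms_grad_lipschitz[OF assms(2,1,3)] by simp
  ultimately show ?thesis
    by (simp add: inner_diff_right)
qed

lemma GDERIV_log_terms:
  assumes "x \<in> Omega"
  shows "GDERIV log_terms x :> log_terms_grad x"
proof -
  have bounds: "0 < 1 + x $ i" "0 < 1 - x $ i" for i
  proof -
    have "\<bar>x $ i\<bar> < 1"
      using assms by (auto simp: mem_Omega_iff)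
    then show "0 < 1 + x $ i" "0 < 1 - x $ i"
      by linarith+
  qed
  have nth: "((\<lambda>y. y $ i) has_derivative (\<lambda>h. h $ i)) (at x)" for i
    by (rule bounded_linear.has_derivative[OF bounded_linear_vec_nth has_derivative_ident])
  have "((\<lambda>y. \<Sum>i\<in>UNIV. ln (1 + y $ i) + ln (1 - y $ i)) has_derivative
      (\<lambda>h. \<Sum>i\<in>UNIV. h $ i * (log_terms_grad x $ i))) (at x)"
    by (rule has_derivative_sum)
       (auto intro!: derivative_eq_intros nth bounds
         simp: fun_eq_iff log_terms_grad_def divide_inverse algebra_simps)
  then show ?thesis
    unfolding gderiv_def inner_vec_def log_terms_def[abs_def] by simp
qed

lemma continuous_on_log_terms_grad:
  assumes "K \<subseteq> Omega"
  shows "continuous_on K log_terms_grad"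
proof -
  have "1 + x $ i \<noteq> 0" "1 - x $ i \<noteq> 0" if "x \<in> K" for x i
  proof -
    have "\<bar>x $ i\<bar> < 1"
      using that assms by (auto simp: mem_Omega_iff)
    then show "1 + x $ i \<noteq> 0" "1 - x $ i \<noteq> 0"
      by (auto simp: abs_if split: if_splits)
  qed
  then show ?thesis
    unfolding log_terms_grad_def[abs_def] by (auto intro!: continuous_intros)
qed

text \<open>Since every summand \<open>ln (1 - (x $ i)\<^sup>2)\<close> is nonpositive, a lower bound on the sum
  bounds each coordinate away from \<open>\<plusminus>1\<close>.\<close>

lemma log_terms_ge_imp_mem_cube:
  fixes x :: "real^'n"
  assumes "x \<in> Omega" "- C \<le> log_terms x"
  shows "x \<in> cube (1 - exp (- C) / 2)"
proof -
  have nonpos: "ln (1 + x $ i) + ln (1 - x $ i) \<le> 0"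
    and eq: "ln (1 + x $ i) + ln (1 - x $ i) = ln ((1 + x $ i) * (1 - x $ i))"
    and lt: "\<bar>x $ i\<bar> < 1" for i
  proof -
    show lt: "\<bar>x $ i\<bar> < 1"
      using assms by (auto simp: mem_Omega_iff)
    then have "0 < 1 + x $ i" "0 < 1 - x $ i"
      by linarith+
    then show "ln (1 + x $ i) + ln (1 - x $ i) = ln ((1 + x $ i) * (1 - x $ i))"
      by (simp add: ln_mult_pos)
    have "ln (1 + x $ i) \<le> x $ i" "ln (1 - x $ i) \<le> - x $ i"
      using ln_le_minus_one[of "1 + x $ i"] ln_le_minus_one[of "1 - x $ i"] lt by auto
    then show "ln (1 + x $ i) + ln (1 - x $ i) \<le> 0" by simp
  qed
  have "\<bar>x $ i\<bar> \<le> 1 - exp (- C) / 2" for i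
  proof -
    have "(\<Sum>j\<in>UNIV - {i}. ln (1 + x $ j) + ln (1 - x $ j)) \<le> 0"
      by (rule sum_nonpos) (rule nonpos)
    then have "log_terms x \<le> ln (1 + x $ i) + ln (1 - x $ i)"
      unfolding log_terms_def by (subst sum.remove[of UNIV i]) auto
    then have "- C \<le> ln ((1 + x $ i) * (1 - x $ i))"
      using assms(2) eq by simp
    moreover have "0 < (1 + x $ i) * (1 - x $ i)"
      using lt[of i] by (intro mult_pos_pos) auto
    ultimately have *: "exp (- C) \<le> (1 + x $ i) * (1 - x $ i)"
      by (metis exp_le_cancel_iff exp_ln)
    have "(1 + x $ i) * (1 - x $ i) = (1 + \<bar>x $ i\<bar>) * (1 - \<bar>x $ i\<bar>)"
      by (auto simp: abs_if)
    also have "\<dots> \<le> 2 * (1 - \<bar>x $ i\<bar>)"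
      using lt[of i] by (intro mult_right_mono) auto
    finally show ?thesis
      using * by simp
  qed
  then show ?thesis
    by (simp add: cube_def)
qed

section \<open>Exact line search along gradient-related directions\<close>

text \<open>If \<open>\<parallel>g (x k)\<parallel> \<ge> \<epsilon>\<close>, then by the mean value theorem a fixed step length \<open>a\<close> lowers \<open>p\<close> by
  \<open>a * \<kappa> * \<epsilon>\<^sup>2 / 2\<close>: it is so small that along the step \<open>g\<close> changes by less than \<open>\<eta>\<close>, and
  \<open>\<eta> * V\<close> is at most half of the guaranteed slope \<open>\<kappa> * \<epsilon>\<^sup>2\<close>. The exact search does at least as
  well, but the decreases of a bounded monotone sequence tend to zero.\<close>

lemma exact_line_search_gradient_tendsto_zero:
  fixes p :: "'a::euclidean_space \<Rightarrow> real"
  assumes K: "compact K" and g: "\<And>y. y \<in> K \<Longrightarrow> GDERIV p y :> g y" and cg: "continuous_on K g"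
    and pos: "0 < a0" "0 < \<kappa>"
    and inK: "\<And>k a. 0 \<le> a \<Longrightarrow> a \<le> a0 \<Longrightarrow> x k + a *\<^sub>R v k \<in> K"
    and search: "\<And>k a. 0 \<le> a \<Longrightarrow> a \<le> a0 \<Longrightarrow> p (x (Suc k)) \<le> p (x k + a *\<^sub>R v k)"
    and v: "\<And>k. norm (v k) \<le> V"
    and descent: "\<And>k. g (x k) \<bullet> v k \<le> - \<kappa> * (norm (g (x k)))\<^sup>2"
  shows "(\<lambda>k. g (x k)) \<longlonglongrightarrow> 0"
proof (rule tendstoI, unfold dist_0_norm dist_norm diff_zero)
  have xK: "x k \<in> K" for k
    using inK[of 0 k] pos by simp
  have "continuous_on K p"
    by (intro continuous_at_imp_continuous_on ballI has_derivative_continuous)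
       (use g in \<open>auto simp: gderiv_def\<close>)
  then have bdd: "bounded (p ` K)"
    using K compact_continuous_image compact_imp_bounded by blast
  have "bounded (range (\<lambda>k. p (x k)))"
    using xK by (intro bounded_subset[OF bdd]) auto
  then have Bs: "Bseq (\<lambda>k. p (x k))"
    by (simp add: Bseq_eq_bounded)
  have "decseq (\<lambda>k. p (x k))"
    using search[of 0] pos by (intro decseq_SucI) simp
  then have "convergent (\<lambda>k. p (x k))"
    using Bs Bseq_monoseq_convergent monoseq_iff by blast
  then obtain l where l: "(\<lambda>k. p (x k)) \<longlonglongrightarrow> l"
    by (auto simp: convergent_def)
  have diff0: "(\<lambda>k. p (x k) - p (x (Suc k))) \<longlonglongrightarrow> 0"
    using tendsto_diff[OF l LIMSEQ_Suc[OF l]] by simp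
  have "0 \<le> V"
    using v[of 0] norm_ge_zero[of "v 0"] by linarith
  fix \<epsilon> :: real assume "0 < \<epsilon>"
  \<comment> \<open>\<open>V + 1\<close> instead of \<open>V\<close> covers the case that all directions vanish.\<close>
  define \<eta> where "\<eta> = \<kappa> * \<epsilon>\<^sup>2 / (2 * (V + 1))"
  have "0 < \<eta>"
    using \<open>0 < \<epsilon>\<close> pos \<open>0 \<le> V\<close> by (simp add: \<eta>_def)
  have \<eta>V: "\<eta> * V \<le> \<kappa> * \<epsilon>\<^sup>2 / 2"
  proof -
    have "\<eta> * V \<le> \<eta> * (V + 1)"
      using \<open>0 < \<eta>\<close> by simp
    also have "\<dots> = \<kappa> * \<epsilon>\<^sup>2 / 2"
      using \<open>0 \<le> V\<close> by (simp add: \<eta>_def field_simps)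
    finally show ?thesis .
  qed
  obtain d where "0 < d" and d: "\<And>y z. y \<in> K \<Longrightarrow> z \<in> K \<Longrightarrow> dist z y < d \<Longrightarrow> dist (g z) (g y) < \<eta>"
    using compact_uniformly_continuous[OF cg K] \<open>0 < \<eta>\<close> unfolding uniformly_continuous_on_def by metis
  define a where "a = min a0 (d / (2 * (V + 1)))"
  have a: "0 < a" "a \<le> a0"
    using pos \<open>0 < d\<close> \<open>0 \<le> V\<close> by (auto simp: a_def)
  have aV: "a * V < d"
  proof -
    have "a * V \<le> d / (2 * (V + 1)) * V"
      using \<open>0 \<le> V\<close> by (intro mult_right_mono) (auto simp: a_def)
    also have "\<dots> \<le> d / (2 * (V + 1)) * (V + 1)"
      using \<open>0 < d\<close> \<open>0 \<le> V\<close> by (intro mult_left_mono) auto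
    also have "\<dots> = d / 2"
      using \<open>0 \<le> V\<close> by (simp add: field_simps)
    finally show ?thesis
      using \<open>0 < d\<close> by simp
  qed
  have decrease: "a * (\<kappa> * \<epsilon>\<^sup>2 / 2) \<le> p (x k) - p (x (Suc k))" if "\<epsilon> \<le> norm (g (x k))" for k
  proof -
    have "((\<lambda>s. p (x k + s *\<^sub>R v k)) has_real_derivative (g (x k + s *\<^sub>R v k) \<bullet> v k)) (at s)"
      if "0 \<le> s" "s \<le> a" for s
    proof -
      have 1: "((\<lambda>s. x k + s *\<^sub>R v k) has_derivative (\<lambda>h. h *\<^sub>R v k)) (at s)"
        by (auto intro!: derivative_eq_intros)
      have 2: "(p has_derivative (\<lambda>h. h \<bullet> g (x k + s *\<^sub>R v k))) (at (x k + s *\<^sub>R v k))"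
        using g inK[of s k] that a by (simp add: gderiv_def)
      show ?thesis
        using has_derivative_compose[OF 1 2]
        by (simp add: has_field_derivative_def inner_commute mult_commute_abs)
    qed
    then obtain s where s: "0 < s" "s < a"
        "p (x k + a *\<^sub>R v k) - p (x k + 0 *\<^sub>R v k) = (a - 0) * (g (x k + s *\<^sub>R v k) \<bullet> v k)"
      using MVT2[of 0 a "\<lambda>s. p (x k + s *\<^sub>R v k)" "\<lambda>s. g (x k + s *\<^sub>R v k) \<bullet> v k"] a by blast
    have sv: "norm (s *\<^sub>R v k) < d"
    proof -
      have "norm (s *\<^sub>R v k) \<le> a * V"
        using s v[of k] by (auto intro!: mult_mono)
      then show ?thesis using aV by simp
    qed
    have "norm (g (x k + s *\<^sub>R v k) - g (x k)) < \<eta>"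
      using d[OF xK inK[of s k], of k] s a sv by (simp add: dist_norm)
    then have "(g (x k + s *\<^sub>R v k) - g (x k)) \<bullet> v k \<le> \<eta> * V"
      by (intro order_trans[OF norm_cauchy_schwarz] mult_mono) (use v \<open>0 < \<eta>\<close> in auto)
    then have "g (x k + s *\<^sub>R v k) \<bullet> v k \<le> - \<kappa> * (norm (g (x k)))\<^sup>2 + \<kappa> * \<epsilon>\<^sup>2 / 2"
      using descent[of k] \<eta>V by (simp add: inner_diff_left)
    also have "\<dots> \<le> - \<kappa> * \<epsilon>\<^sup>2 + \<kappa> * \<epsilon>\<^sup>2 / 2"
      using that \<open>0 < \<epsilon>\<close> pos by (simp add: power_mono)
    finally have "a * (g (x k + s *\<^sub>R v k) \<bullet> v k) \<le> a * (- (\<kappa> * \<epsilon>\<^sup>2 / 2))"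
      using a by (intro mult_left_mono) auto
    then show ?thesis
      using s(3) search[of a k] a by simp
  qed
  have "0 < a * (\<kappa> * \<epsilon>\<^sup>2 / 2)"
    using a pos \<open>0 < \<epsilon>\<close> by simp
  then have "\<forall>\<^sub>F k in sequentially. p (x k) - p (x (Suc k)) < a * (\<kappa> * \<epsilon>\<^sup>2 / 2)"
    using diff0 by (rule order_tendstoD(2)[rotated])
  then show "\<forall>\<^sub>F k in sequentially. norm (g (x k)) < \<epsilon>"
    by eventually_elim (use decrease in \<open>force simp: not_le[symmetric]\<close>)
qed

text \<open>Otherwise some subsequence stays away from the zeros of \<open>g\<close>, but it accumulates at a point
  of \<open>K\<close>, which is a zero by continuity.\<close>

lemma eventually_close_to_zero_set:
  fixes g :: "'a::metric_space \<Rightarrow> 'b::real_normed_vector"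
  assumes "compact K" "continuous_on K g" "\<And>k. x k \<in> K" "(\<lambda>k. g (x k)) \<longlonglongrightarrow> 0" "0 < \<epsilon>"
  shows "\<forall>\<^sub>F k in sequentially. \<exists>\<xi>\<in>K. g \<xi> = 0 \<and> dist (x k) \<xi> < \<epsilon>"
proof (rule ccontr)
  define bad where "bad k \<longleftrightarrow> \<not> (\<exists>\<xi>\<in>K. g \<xi> = 0 \<and> dist (x k) \<xi> < \<epsilon>)" for k
  assume "\<not> ?thesis"
  then have "\<exists>\<^sub>F k in sequentially. bad k"
    by (simp add: frequently_def bad_def)
  then have "infinite {k. bad k}"
    by (simp add: frequently_cofinite cofinite_eq_sequentially[symmetric])
  then obtain s :: "nat \<Rightarrow> nat" where s: "strict_mono s" "\<And>k. bad (s k)"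
    using infinite_enumerate by (metis mem_Collect_eq)
  obtain l r where l: "l \<in> K" "strict_mono r" "((x \<circ> s) \<circ> r) \<longlonglongrightarrow> l"
    using assms(1,3) unfolding compact_def by (metis comp_apply)
  have lim: "(\<lambda>k. g (((x \<circ> s) \<circ> r) k)) \<longlonglongrightarrow> g l"
    using continuous_on_tendsto_compose[OF assms(2) l(3,1)] assms(3) by simp
  have "(\<lambda>k. g (((x \<circ> s) \<circ> r) k)) \<longlonglongrightarrow> 0"
    using LIMSEQ_subseq_LIMSEQ[OF LIMSEQ_subseq_LIMSEQ[OF assms(4) s(1)] l(2)] by (simp add: o_def)
  then have "g l = 0"
    using lim LIMSEQ_unique by blast
  obtain k where "dist (((x \<circ> s) \<circ> r) k) l < \<epsilon>"
    using tendstoD[OF l(3) assms(5)] eventually_happens'[OF sequentially_bot] by blast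
  then show False
    using s(2)[of "r k"] l(1) \<open>g l = 0\<close> by (auto simp: bad_def)
qed

section \<open>Derivatives of the constraints\<close>

text \<open>Componentwise smoothness is how the constraints are given; these lemmas turn it into
  statements about the matrices that occur in the algorithm.\<close>

lemma constraint_differentiable:
  fixes c :: "real^'n \<Rightarrow> real^'m"
  assumes "\<And>j. twice_lipschitz_differentiable (\<lambda>y. c y $ j)"
  shows "c differentiable (at x)"
proof -
  have "((\<lambda>y. c y $ j) has_derivative (\<lambda>h. h \<bullet> grad (\<lambda>y. c y $ j) x)) (at x)" for j
    using assms[of j] GDERIV_grad[of "\<lambda>y. c y $ j" x]
    by (auto simp: twice_lipschitz_differentiable_def gderiv_def)
  then have "(c has_derivative (\<lambda>h. \<chi> j. h \<bullet> grad (\<lambda>y. c y $ j) x)) (at x)"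
    by (subst has_derivative_componentwise_within)
       (auto simp: Basis_vec_def inner_axis)
  then show ?thesis
    by (rule differentiableI)
qed

lemma constraint_has_derivative:
  fixes c :: "real^'n \<Rightarrow> real^'m"
  assumes "\<And>j. twice_lipschitz_differentiable (\<lambda>y. c y $ j)"
  shows "(c has_derivative (\<lambda>h. transpose (transposed_jacobian c x) *v h)) (at x)"
  using constraint_differentiable[of c x, OF assms]
  by (simp add: transposed_jacobian_def transpose_transpose flip: jacobian_works)

lemma transposed_jacobian_eq:
  fixes c :: "real^'n \<Rightarrow> real^'m"
  assumes "\<And>j. twice_lipschitz_differentiable (\<lambda>y. c y $ j)"
  shows "transposed_jacobian c x = (\<chi> i j. grad (\<lambda>y. c y $ j) x $ i)"
proof -
  have "GDERIV (\<lambda>y. c y $ j) x :> transpose (transposed_jacobian c x) $ j" for j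
    unfolding gderiv_def
    using bounded_linear.has_derivative[OF bounded_linear_vec_nth constraint_has_derivative[of c x, OF assms], of j]
    by (simp add: matrix_vector_mul_component inner_commute)
  then have "grad (\<lambda>y. c y $ j) x = transpose (transposed_jacobian c x) $ j" for j
    by (rule grad_eqI)
  then show ?thesis
    by (simp add: vec_eq_iff transpose_def)
qed

lemma continuous_on_constraint:
  fixes c :: "real^'n \<Rightarrow> real^'m"
  assumes "\<And>j. twice_lipschitz_differentiable (\<lambda>y. c y $ j)"
  shows "continuous_on A c"
  using constraint_differentiable[of c, OF assms]
  by (intro continuous_at_imp_continuous_on) (auto intro: differentiable_imp_continuous_within)

lemma continuous_on_transposed_jacobian:
  fixes c :: "real^'n \<Rightarrow> real^'m"
  assumes "\<And>j. twice_lipschitz_differentiable (\<lambda>y. c y $ j)"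
  shows "continuous_on A (transposed_jacobian c)"
proof -
  have eq: "transposed_jacobian c = (\<lambda>x. \<chi> i j. grad (\<lambda>y. c y $ j) x $ i)"
    using transposed_jacobian_eq[of c, OF assms] by (simp add: fun_eq_iff)
  show ?thesis
    unfolding eq by (intro continuous_intros continuous_on_grad assms)
qed

text \<open>The multiplier is fixed while the Lagrangian is differentiated, so the exact Hessian is a
  linear combination of Hessians with coefficients depending continuously on \<open>x\<close>.\<close>

lemma exact_hessian_eq:
  fixes c :: "real^'n \<Rightarrow> real^'m"
  assumes f: "twice_lipschitz_differentiable f"
    and c: "\<And>j. twice_lipschitz_differentiable (\<lambda>y. c y $ j)"
  shows "exact_hessian \<omega> f c x
    = hessian f x - (\<Sum>j\<in>UNIV. (- (1 / \<omega>) * c x $ j) *\<^sub>R hessian (\<lambda>y. c y $ j) x)"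
proof -
  define l where "l = - (1 / \<omega>) *\<^sub>R c x"
  have hess: "(grad g has_derivative (\<lambda>h. hessian g z *v h)) (at z)"
    if "twice_lipschitz_differentiable g" for g :: "real^'n \<Rightarrow> real" and z
    using that jacobian_works unfolding hessian_def twice_lipschitz_differentiable_def by blast
  have gder: "GDERIV g z :> grad g z"
    if "twice_lipschitz_differentiable g" for g :: "real^'n \<Rightarrow> real" and z
    using that GDERIV_grad unfolding twice_lipschitz_differentiable_def by blast
  have scaled: "GDERIV (\<lambda>y. l $ j * c y $ j) z :> l $ j *\<^sub>R grad (\<lambda>y. c y $ j) z" for j z
    using has_derivative_mult_right[OF gder[OF c[of j], unfolded gderiv_def], of "l $ j" z]
    by (simp add: gderiv_def)
  have "GDERIV (\<lambda>y. lagrangian f c y l) z :> grad f z - (\<Sum>j\<in>UNIV. l $ j *\<^sub>R grad (\<lambda>y. c y $ j) z)" for z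
    unfolding lagrangian_def inner_vec_def inner_real_def
    by (intro GDERIV_diff GDERIV_sum gder f scaled)
  then have "grad (\<lambda>y. lagrangian f c y l)
      = (\<lambda>z. grad f z - (\<Sum>j\<in>UNIV. l $ j *\<^sub>R grad (\<lambda>y. c y $ j) z))"
    using grad_eqI by blast
  moreover have "((\<lambda>z. grad f z - (\<Sum>j\<in>UNIV. l $ j *\<^sub>R grad (\<lambda>y. c y $ j) z)) has_derivative
      (\<lambda>h. hessian f x *v h - (\<Sum>j\<in>UNIV. l $ j *\<^sub>R (hessian (\<lambda>y. c y $ j) x *v h)))) (at x)"
    by (intro has_derivative_diff has_derivative_sum has_derivative_scaleR_right hess f c)
  moreover have "hessian f x *v h - (\<Sum>j\<in>UNIV. l $ j *\<^sub>R (hessian (\<lambda>y. c y $ j) x *v h))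
      = (hessian f x - (\<Sum>j\<in>UNIV. l $ j *\<^sub>R hessian (\<lambda>y. c y $ j) x)) *v h" for h
  proof -
    have "(\<Sum>j\<in>J. l $ j *\<^sub>R hessian (\<lambda>y. c y $ j) x) *v h
        = (\<Sum>j\<in>J. l $ j *\<^sub>R (hessian (\<lambda>y. c y $ j) x *v h))" for J
      by (induction J rule: infinite_finite_induct)
         (simp_all add: matrix_vector_mult_add_rdistrib scaleR_matrix_vector_assoc)
    then show ?thesis
      by (simp add: matrix_vector_mult_diff_rdistrib)
  qed
  ultimately have "(grad (\<lambda>y. lagrangian f c y l) has_derivative
      (\<lambda>h. (hessian f x - (\<Sum>j\<in>UNIV. l $ j *\<^sub>R hessian (\<lambda>y. c y $ j) x)) *v h)) (at x)"
    by simp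
  then have "hessian (\<lambda>y. lagrangian f c y l) x
      = hessian f x - (\<Sum>j\<in>UNIV. l $ j *\<^sub>R hessian (\<lambda>y. c y $ j) x)"
    unfolding hessian_def jacobian_def by (simp flip: frechet_derivative_at)
  then show ?thesis
    by (simp add: exact_hessian_def Let_def l_def)
qed

lemma continuous_on_exact_hessian:
  fixes c :: "real^'n \<Rightarrow> real^'m"
  assumes f: "twice_lipschitz_differentiable f"
    and c: "\<And>j. twice_lipschitz_differentiable (\<lambda>y. c y $ j)"
  shows "continuous_on A (exact_hessian \<omega> f c)"
proof -
  have eq: "exact_hessian \<omega> f c = (\<lambda>x. hessian f x
      - (\<Sum>j\<in>UNIV. (- (1 / \<omega>) * c x $ j) *\<^sub>R hessian (\<lambda>y. c y $ j) x))"
    using exact_hessian_eq[OF f c] by (simp add: fun_eq_iff)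
  show ?thesis
    unfolding eq by (intro continuous_intros continuous_on_hessian continuous_on_constraint f c)
qed

section \<open>The penalty-barrier function and its convex model\<close>

definition phi_grad ::
  "real \<Rightarrow> real \<Rightarrow> real \<Rightarrow> real^'n^'n \<Rightarrow> (real^'n \<Rightarrow> real) \<Rightarrow> (real^'n \<Rightarrow> real^'m) \<Rightarrow> real^'n \<Rightarrow> real^'n"
where
  "phi_grad \<rho> \<omega> \<tau> S f c x =
     grad f x + \<rho> *\<^sub>R (S *v x) + (1 / \<omega>) *\<^sub>R (transposed_jacobian c x *v c x)
       - \<tau> *\<^sub>R log_terms_grad x"

lemma inner_transpose:
  fixes T :: "real^'m^'n"
  shows "z \<bullet> (transpose T *v d) = d \<bullet> (T *v z)"
  by (metis dot_lmul_matrix inner_commute transpose_matrix_vector)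

lemma GDERIV_phi:
  fixes c :: "real^'n \<Rightarrow> real^'m"
  assumes f: "twice_lipschitz_differentiable f"
    and c: "\<And>j. twice_lipschitz_differentiable (\<lambda>y. c y $ j)"
    and S: "transpose S = S" and x: "x \<in> Omega"
  shows "GDERIV (phi \<rho> \<omega> \<tau> S f c) x :> phi_grad \<rho> \<omega> \<tau> S f c x"
proof -
  have df: "(f has_derivative (\<lambda>h. h \<bullet> grad f x)) (at x)"
    using f GDERIV_grad by (auto simp: twice_lipschitz_differentiable_def gderiv_def)
  have dS: "((\<lambda>y. y \<bullet> (S *v y)) has_derivative (\<lambda>h. h \<bullet> (2 *\<^sub>R (S *v x)))) (at x)"
    using GDERIV_quadratic_form[OF S] by (simp add: gderiv_def)
  have dc: "((\<lambda>y. (norm (c y))\<^sup>2) has_derivative (\<lambda>h. h \<bullet> (2 *\<^sub>R (transposed_jacobian c x *v c x)))) (at x)"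
    unfolding power2_norm_eq_inner
    by (rule has_derivative_eq_rhs[OF has_derivative_inner[OF constraint_has_derivative[of c x, OF c]
            constraint_has_derivative[of c x, OF c]]])
       (simp add: fun_eq_iff inner_transpose[of "c x", symmetric] inner_commute)
  have dl: "(log_terms has_derivative (\<lambda>h. h \<bullet> log_terms_grad x)) (at x)"
    using GDERIV_log_terms[OF x] by (simp add: gderiv_def)
  show ?thesis
    unfolding gderiv_def phi_def[abs_def]
    by (rule has_derivative_eq_rhs[OF has_derivative_diff[OF has_derivative_add[OF has_derivative_add[OF df
            has_derivative_mult_right[OF dS]] has_derivative_mult_right[OF dc]] has_derivative_mult_right[OF dl]]])
       (simp add: fun_eq_iff phi_grad_def inner_add_right inner_diff_right)
qed

lemma continuous_on_phi_grad:
  fixes c :: "real^'n \<Rightarrow> real^'m"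
  assumes f: "twice_lipschitz_differentiable f"
    and c: "\<And>j. twice_lipschitz_differentiable (\<lambda>y. c y $ j)"
    and K: "K \<subseteq> Omega"
  shows "continuous_on K (phi_grad \<rho> \<omega> \<tau> S f c)"
proof -
  have "continuous_on K (\<lambda>x. transposed_jacobian c x *v c x)"
    unfolding matrix_vector_mult_def
    by (intro continuous_intros continuous_on_transposed_jacobian continuous_on_constraint c)
  moreover have "continuous_on K (\<lambda>x. S *v x)"
    by (intro bounded_linear.continuous_on[OF matrix_vector_mul_bounded_linear] continuous_intros)
  ultimately show ?thesis
    unfolding phi_grad_def[abs_def]
    by (intro continuous_intros continuous_on_grad continuous_on_log_terms_grad f K)
qed

text \<open>The model is a quadratic plus the barrier. In the linear term the contributions
  \<open>H *v x\<close> cancel, whatever \<open>H\<close> is, and what remains is the gradient of \<open>\<phi>\<close>. The barrier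
  is split into its linear part, which belongs to that gradient, and a remainder that is
  controlled by the two bounds on \<open>log_terms\<close>.\<close>

lemma model_q_diff:
  fixes c :: "real^'n \<Rightarrow> real^'m" and d :: "real^'n"
  assumes S: "transpose S = S" and M: "transpose (model_matrix \<omega> c x H) = model_matrix \<omega> c x H"
  shows "model_q \<rho> \<omega> \<tau> S f c x H (x + d) - model_q \<rho> \<omega> \<tau> S f c x H x
    = d \<bullet> (phi_grad \<rho> \<omega> \<tau> S f c x) + 1 / 2 * (d \<bullet> ((model_matrix \<omega> c x H + \<rho> *\<^sub>R S) *v d))
      - \<tau> * (log_terms (x + d) - log_terms x - d \<bullet> log_terms_grad x)"
proof -
  define T where "T = transposed_jacobian c x"
  have T: "transpose (T ** transpose T) = T ** transpose T"
    by (simp add: matrix_transpose_mul transpose_transpose)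
  have "H = model_matrix \<omega> c x H - (1 / \<omega>) *\<^sub>R (T ** transpose T)"
    by (simp add: model_matrix_def T_def)
  moreover have "transpose (A - B) = transpose A - transpose B" for A B :: "real^'n^'n"
    by (simp add: transpose_def vec_eq_iff)
  ultimately have H: "transpose H = H"
    using M T by (metis transpose_scalar)
  have Q: "transpose (H + \<rho> *\<^sub>R S) = H + \<rho> *\<^sub>R S"
    using H S by (simp add: transpose_def vec_eq_iff)
  have norm_sq: "(norm (c x + transpose T *v d))\<^sup>2
      = (norm (c x))\<^sup>2 + 2 * (d \<bullet> (T *v c x)) + d \<bullet> ((T ** transpose T) *v d)"
  proof -
    have "(transpose T *v d) \<bullet> (transpose T *v d) = d \<bullet> ((T ** transpose T) *v d)"
      by (simp add: inner_transpose matrix_vector_mul_assoc)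
    then show ?thesis
      using inner_transpose[of "c x" T d] inner_commute[of "c x" "transpose T *v d"]
      by (simp add: power2_norm_eq_inner inner_add_left inner_add_right)
  qed
  have "d \<bullet> ((model_matrix \<omega> c x H + \<rho> *\<^sub>R S) *v d)
      = d \<bullet> ((H + \<rho> *\<^sub>R S) *v d) + 1 / \<omega> * (d \<bullet> ((T ** transpose T) *v d))"
    by (simp add: model_matrix_def T_def matrix_vector_mult_add_rdistrib inner_add_right
        flip: scaleR_matrix_vector_assoc)
  moreover have "d \<bullet> ((H + \<rho> *\<^sub>R S) *v x) = d \<bullet> (H *v x) + \<rho> * (d \<bullet> (S *v x))"
    by (simp add: matrix_vector_mult_add_rdistrib inner_add_right flip: scaleR_matrix_vector_assoc)
  moreover have residual: "transpose T *v (x + d) - (- c x + transpose T *v x) = c x + transpose T *v d"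
    "transpose T *v x - (- c x + transpose T *v x) = c x"
    by (simp_all add: matrix_vector_right_distrib)
  ultimately show ?thesis
    unfolding model_q_def Let_def quadratic_form_add[OF Q] T_def[symmetric] phi_grad_def residual norm_sq
    using inner_commute[of d "grad f x"] inner_commute[of d "H *v x"]
    by (simp add: inner_add_right inner_diff_right inner_diff_left distrib_left right_diff_distrib
        add_divide_distrib)
qed

text \<open>The first condition on \<open>t\<close> keeps the comparison point \<open>x - t g\<close> at distance at least \<open>\<delta>\<close>
  from the faces of the cube. In the second, \<open>B\<close> bounds the curvature of the quadratic part and
  \<open>4 * \<tau> / \<delta>\<^sup>2\<close> that of the barrier, so that at most half of the linear decrease
  \<open>t * (norm g)\<^sup>2\<close> is lost to second-order terms.\<close>

lemma model_minimizer_descent: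
  fixes c :: "real^'n \<Rightarrow> real^'m" and H :: "real^'n^'n" and x :: "real^'n"
  assumes S: "sym_pos_semidef S" and M: "sym_pos_semidef (model_matrix \<omega> c x H)"
    and params: "0 \<le> \<rho>" "0 \<le> \<tau>"
    and min: "is_arg_min (model_q \<rho> \<omega> \<tau> S f c x H) (\<lambda>y. y \<in> Omega) xhat"
    and x: "x \<in> cube (1 - 2 * \<delta>)" "0 < \<delta>"
    and B: "norm (model_matrix \<omega> c x H + \<rho> *\<^sub>R S) \<le> B"
    and t: "0 \<le> t" "t * norm (phi_grad \<rho> \<omega> \<tau> S f c x) \<le> \<delta>" "t * (B + 4 * \<tau> / \<delta>\<^sup>2) \<le> 1"
  shows "phi_grad \<rho> \<omega> \<tau> S f c x \<bullet> (xhat - x)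
    \<le> - (t / 2) * (norm (phi_grad \<rho> \<omega> \<tau> S f c x))\<^sup>2"
proof -
  define g where "g = phi_grad \<rho> \<omega> \<tau> S f c x"
  define N where "N = model_matrix \<omega> c x H + \<rho> *\<^sub>R S"
  define q where "q = model_q \<rho> \<omega> \<tau> S f c x H"
  have diff: "q (x + d) - q x = d \<bullet> g + 1 / 2 * (d \<bullet> (N *v d))
      - \<tau> * (log_terms (x + d) - log_terms x - d \<bullet> log_terms_grad x)" for d
    using S M unfolding q_def g_def N_def by (intro model_q_diff) (auto simp: sym_pos_semidef_def)
  have xhat: "xhat \<in> Omega" "\<And>y. y \<in> Omega \<Longrightarrow> q xhat \<le> q y"
    using min by (auto simp: is_arg_min_linorder q_def)
  have x_Omega: "x \<in> Omega"
    using x cube_subset_Omega[of "1 - 2 * \<delta>"] by auto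
  \<comment> \<open>By convexity the model lies above its tangent plane at \<open>x\<close>.\<close>
  have lower: "(xhat - x) \<bullet> g \<le> q xhat - q x"
  proof -
    have "0 \<le> (xhat - x) \<bullet> (N *v (xhat - x))"
      using S M params
      by (simp add: sym_pos_semidef_def N_def matrix_vector_mult_add_rdistrib inner_add_right
          flip: scaleR_matrix_vector_assoc)
    moreover have "\<tau> * (log_terms xhat - log_terms x - (xhat - x) \<bullet> log_terms_grad x) \<le> 0"
      using log_terms_supergradient[OF x_Omega xhat(1)] params by (intro mult_nonneg_nonpos) auto
    ultimately show ?thesis
      using diff[of "xhat - x"] by simp
  qed
  \<comment> \<open>The comparison point is a gradient step with step size \<open>t\<close>.\<close>
  define d where "d = - t *\<^sub>R g"
  have norm_d: "norm d = t * norm g"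
    using t by (simp add: d_def)
  have xd: "x + d \<in> cube (1 - \<delta>)"
    using cube_add[OF x(1), of d \<delta>] norm_d t by (simp add: g_def)
  have "x \<in> cube (1 - \<delta>)"
    using x cube_mono[of "1 - 2 * \<delta>" "1 - \<delta>"] by auto
  then have log: "- \<tau> * (log_terms (x + d) - log_terms x - d \<bullet> log_terms_grad x)
      \<le> \<tau> * (2 / \<delta>\<^sup>2 * (norm d)\<^sup>2)"
    using mult_left_mono[OF log_terms_lower_model[OF _ xd x(2)] params(2)] by (simp add: right_diff_distrib)
  have quad: "d \<bullet> (N *v d) \<le> B * (norm d)\<^sup>2"
  proof -
    have "d \<bullet> (N *v d) \<le> norm d * (norm N * norm d)"
      by (intro order_trans[OF norm_cauchy_schwarz] mult_left_mono norm_matrix_vector_mult_le) simp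
    also have "\<dots> \<le> norm d * (B * norm d)"
      using B by (intro mult_left_mono mult_right_mono) (auto simp: N_def)
    finally show ?thesis
      by (simp add: power2_eq_square mult_ac)
  qed
  have "q xhat \<le> q (x + d)"
    using xhat(2) xd cube_subset_Omega[of "1 - \<delta>"] x(2) by auto
  also have "\<dots> - q x \<le> d \<bullet> g + 1 / 2 * (B * (norm d)\<^sup>2) + \<tau> * (2 / \<delta>\<^sup>2 * (norm d)\<^sup>2)"
    using diff[of d] quad log by simp
  finally have "q xhat - q x \<le> d \<bullet> g + 1 / 2 * (B * (norm d)\<^sup>2) + \<tau> * (2 / \<delta>\<^sup>2 * (norm d)\<^sup>2)"
    by simp
  also have "\<dots> = - t * (norm g)\<^sup>2 + (t * (B + 4 * \<tau> / \<delta>\<^sup>2)) * (t / 2 * (norm g)\<^sup>2)"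
    unfolding norm_d by (simp add: d_def power2_norm_eq_inner[of g, symmetric] field_simps power2_eq_square)
  also have "\<dots> \<le> - t * (norm g)\<^sup>2 + 1 * (t / 2 * (norm g)\<^sup>2)"
    using t by (intro add_left_mono mult_right_mono) auto
  finally show ?thesis
    using lower by (simp add: g_def inner_commute)
qed

section \<open>Boundedness along the iteration\<close>

text \<open>All terms of \<open>\<phi>\<close> other than the barrier are bounded below, so the barrier is bounded above
  on a sublevel set. The factor 2 leaves room for steps that stay in \<open>cube (1 - \<delta>)\<close>.\<close>

lemma phi_sublevel_subset_cube:
  fixes c :: "real^'n \<Rightarrow> real^'m" and f :: "real^'n \<Rightarrow> real"
  assumes params: "0 \<le> \<rho>" "0 \<le> \<omega>" "0 < \<tau>" and S: "sym_pos_semidef S" and f: "bounded (range f)"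
  obtains \<delta> where "0 < \<delta>" "{x \<in> Omega. phi \<rho> \<omega> \<tau> S f c x \<le> l} \<subseteq> cube (1 - 2 * \<delta>)"
proof -
  obtain F where F: "\<And>y. \<bar>f y\<bar> \<le> F"
    using f by (auto simp: bounded_iff)
  define C where "C = (l + F) / \<tau>"
  have "x \<in> cube (1 - exp (- C) / 2)" if x: "x \<in> Omega" "phi \<rho> \<omega> \<tau> S f c x \<le> l" for x
  proof -
    have "0 \<le> \<rho> / 2 * (x \<bullet> (S *v x))" "0 \<le> 1 / (2 * \<omega>) * (norm (c x))\<^sup>2"
      using params S by (simp_all add: sym_pos_semidef_def)
    then have "- (l + F) \<le> \<tau> * log_terms x"
      using x(2) F[of x] unfolding phi_def abs_le_iff by linarith
    then have "- C \<le> log_terms x"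
      using params by (simp add: C_def field_simps)
    then show ?thesis
      by (rule log_terms_ge_imp_mem_cube[OF x(1)])
  qed
  then show ?thesis
    by (intro that[of "exp (- C) / 4"]) auto
qed

lemma bounded_model_matrices:
  fixes c :: "real^'n \<Rightarrow> real^'m" and H :: "nat \<Rightarrow> real^'n^'n"
  assumes f: "twice_lipschitz_differentiable f"
    and c: "\<And>j. twice_lipschitz_differentiable (\<lambda>y. c y $ j)"
    and K: "compact K" "\<And>k. x k \<in> K"
    and H: "bounded (range (\<lambda>k. H k - exact_hessian \<omega> f c (x k)))"
  shows "bounded (range (\<lambda>k. model_matrix \<omega> c (x k) (H k)))"
proof -
  define E where "E y = exact_hessian \<omega> f c y
    + (1 / \<omega>) *\<^sub>R (transposed_jacobian c y ** transpose (transposed_jacobian c y))" for y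
  have "continuous_on K (\<lambda>y. transposed_jacobian c y ** transpose (transposed_jacobian c y))"
    unfolding matrix_matrix_mult_def transpose_def
    by (intro continuous_intros continuous_on_transposed_jacobian c)
  then have "continuous_on K E"
    unfolding E_def by (intro continuous_intros continuous_on_exact_hessian f c)
  then have "bounded (E ` K)"
    using K(1) compact_continuous_image compact_imp_bounded by blast
  then have "bounded (range (\<lambda>k. E (x k)))"
    by (rule bounded_subset) (use K in auto)
  from bounded_plus_comp[OF H this] show ?thesis
    by (simp add: model_matrix_def E_def)
qed

lemma ppd_ipm_stepD:
  assumes "ppd_ipm_step \<rho> \<omega> \<tau> S f c xk Hk xk'"
  obtains xhat where
    "is_arg_min (model_q \<rho> \<omega> \<tau> S f c xk Hk) (\<lambda>y. y \<in> Omega) xhat"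
    "sym_pos_semidef (model_matrix \<omega> c xk Hk)"
    "xk' \<in> Omega"
    "\<And>a. 0 \<le> a \<Longrightarrow> xk + a *\<^sub>R (xhat - xk) \<in> Omega \<Longrightarrow>
        phi \<rho> \<omega> \<tau> S f c xk' \<le> phi \<rho> \<omega> \<tau> S f c (xk + a *\<^sub>R (xhat - xk))"
  using assms unfolding ppd_ipm_step_def is_arg_min_linorder by (metis (no_types, lifting))

lemma ppd_ipm_iterates_mem_sublevel:
  assumes "ppd_ipm_iterates \<rho> \<omega> \<tau> S f c H x"
  shows "x k \<in> Omega \<and> phi \<rho> \<omega> \<tau> S f c (x k) \<le> phi \<rho> \<omega> \<tau> S f c (x 0)"
proof (induction k)
  case 0
  then show ?case
    using assms by (simp add: ppd_ipm_iterates_def)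
next
  case (Suc k)
  have "ppd_ipm_step \<rho> \<omega> \<tau> S f c (x k) (H k) (x (Suc k))"
    using assms by (simp add: ppd_ipm_iterates_def)
  then show ?case
  proof (rule ppd_ipm_stepD)
    fix xhat
    assume "x (Suc k) \<in> Omega"
      and "\<And>a. 0 \<le> a \<Longrightarrow> x k + a *\<^sub>R (xhat - x k) \<in> Omega \<Longrightarrow>
        phi \<rho> \<omega> \<tau> S f c (x (Suc k)) \<le> phi \<rho> \<omega> \<tau> S f c (x k + a *\<^sub>R (xhat - x k))"
    from this(1) this(2)[of 0] Suc.IH show ?thesis
      by simp
  qed
qed

lemma sym_pos_def_imp_semidef: "sym_pos_def M \<Longrightarrow> sym_pos_semidef M"
  unfolding sym_pos_def_def sym_pos_semidef_def by (metis inner_zero_left less_imp_le order_refl)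

section \<open>Convergence\<close>

theorem theorem3p5:
  fixes \<rho> \<omega> \<tau> :: real
    and S :: "real^'n^'n"
    and f :: "real^'n \<Rightarrow> real"
    and c :: "real^'n \<Rightarrow> real^'m"
    and H :: "nat \<Rightarrow> real^'n^'n"
    and x :: "nat \<Rightarrow> real^'n"
  assumes "\<rho> > 0" and "\<omega> > 0" and "\<tau> > 0"
    and "sym_pos_def S"
    and "bounded (range f)" and "twice_lipschitz_differentiable f"
    and "bounded (range c)" and "\<And>i. twice_lipschitz_differentiable (\<lambda>y. c y $ i)"
    and "ppd_ipm_iterates \<rho> \<omega> \<tau> S f c H x"
  shows "(\<forall>x_inf. x \<longlonglongrightarrow> x_inf \<longrightarrow>
            x_inf \<in> Omega \<and> norm (grad (phi \<rho> \<omega> \<tau> S f c) x_inf) = 0)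
       \<and> (\<forall>\<epsilon>>0. \<forall>\<^sub>F k in sequentially.
            \<exists>\<xi>\<in>Omega. norm (grad (phi \<rho> \<omega> \<tau> S f c) \<xi>) = 0 \<and> dist (x k) \<xi> < \<epsilon>)"
proof -
  note f = assms(6) and c = assms(8)
  define p where "p = phi \<rho> \<omega> \<tau> S f c"
  define g where "g = phi_grad \<rho> \<omega> \<tau> S f c"
  have S: "sym_pos_semidef S"
    using assms(4) by (rule sym_pos_def_imp_semidef)
  have gder: "GDERIV p y :> g y" if "y \<in> Omega" for y
    using GDERIV_phi[OF f c _ that] S unfolding p_def g_def sym_pos_semidef_def by blast
  have cg: "continuous_on K g" if "K \<subseteq> Omega" for K
    using continuous_on_phi_grad[OF f c that] by (simp add: g_def)
  obtain \<delta> where \<delta>: "0 < \<delta>" "{y \<in> Omega. p y \<le> p (x 0)} \<subseteq> cube (1 - 2 * \<delta>)"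
    unfolding p_def
    by (rule phi_sublevel_subset_cube[OF less_imp_le[OF assms(1)] less_imp_le[OF assms(2)] assms(3) S assms(5)])
  have cube_Omega: "cube (1 - 2 * \<delta>) \<subseteq> Omega" "cube (1 - \<delta>) \<subseteq> Omega"
    using \<delta>(1) by (auto intro!: cube_subset_Omega)
  have xK: "x k \<in> cube (1 - 2 * \<delta>)" for k
    using \<delta>(2) ppd_ipm_iterates_mem_sublevel[OF assms(9), of k] by (auto simp: p_def)

  have "\<forall>k. \<exists>w. is_arg_min (model_q \<rho> \<omega> \<tau> S f c (x k) (H k)) (\<lambda>y. y \<in> Omega) w
      \<and> sym_pos_semidef (model_matrix \<omega> c (x k) (H k))
      \<and> (\<forall>a\<ge>0. x k + a *\<^sub>R (w - x k) \<in> Omega \<longrightarrow> p (x (Suc k)) \<le> p (x k + a *\<^sub>R (w - x k)))"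
  proof
    fix k
    have "ppd_ipm_step \<rho> \<omega> \<tau> S f c (x k) (H k) (x (Suc k))"
      using assms(9) by (simp add: ppd_ipm_iterates_def)
    then show "\<exists>w. is_arg_min (model_q \<rho> \<omega> \<tau> S f c (x k) (H k)) (\<lambda>y. y \<in> Omega) w
        \<and> sym_pos_semidef (model_matrix \<omega> c (x k) (H k))
        \<and> (\<forall>a\<ge>0. x k + a *\<^sub>R (w - x k) \<in> Omega \<longrightarrow> p (x (Suc k)) \<le> p (x k + a *\<^sub>R (w - x k)))"
      unfolding p_def by (rule ppd_ipm_stepD) blast
  qed
  then obtain w where w: "\<And>k. is_arg_min (model_q \<rho> \<omega> \<tau> S f c (x k) (H k)) (\<lambda>y. y \<in> Omega) (w k)"
    and M: "\<And>k. sym_pos_semidef (model_matrix \<omega> c (x k) (H k))"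
    and search: "\<And>k a. 0 \<le> a \<Longrightarrow> x k + a *\<^sub>R (w k - x k) \<in> Omega \<Longrightarrow>
        p (x (Suc k)) \<le> p (x k + a *\<^sub>R (w k - x k))"
    by metis

  have "bounded (range (\<lambda>k. model_matrix \<omega> c (x k) (H k) + \<rho> *\<^sub>R S))"
    using bounded_model_matrices[OF f c compact_cube xK] assms(9)
    by (intro bounded_plus_comp) (auto simp: ppd_ipm_iterates_def)
  then obtain B where "0 < B" and B: "\<And>k. norm (model_matrix \<omega> c (x k) (H k) + \<rho> *\<^sub>R S) \<le> B"
    by (auto simp: bounded_pos)
  have "bounded (g ` cube (1 - 2 * \<delta>))"
    by (intro compact_imp_bounded compact_continuous_image cg cube_Omega compact_cube)
  then obtain G where "0 < G" and G: "\<And>k. norm (g (x k)) \<le> G"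
    using xK by (auto simp: bounded_pos)
  obtain R where "0 < R" and R: "\<And>y :: real^'n. y \<in> Omega \<Longrightarrow> norm y \<le> R"
  proof -
    have "Omega \<subseteq> (cube 1 :: (real^'n) set)"
      by (auto simp: mem_Omega_iff cube_def less_imp_le)
    then have "bounded (Omega :: (real^'n) set)"
      using bounded_subset compact_imp_bounded compact_cube by blast
    then show ?thesis
      using that by (auto simp: bounded_pos)
  qed
  have V: "norm (w k - x k) \<le> 2 * R" for k
    using norm_triangle_ineq4[of "w k" "x k"] R[of "w k"] R[of "x k"] w[of k] xK[of k] cube_Omega
    by (auto simp: is_arg_min_linorder)

  define t where "t = min (\<delta> / G) (1 / (B + 4 * \<tau> / \<delta>\<^sup>2))"
  have denom: "0 < B + 4 * \<tau> / \<delta>\<^sup>2"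
    using \<open>0 < B\<close> assms(3) \<delta>(1) by (simp add: add_pos_pos)
  have "0 < t"
    using \<delta>(1) \<open>0 < G\<close> denom by (simp add: t_def)
  have tG: "t * norm (g (x k)) \<le> \<delta>" for k
  proof -
    have "t * norm (g (x k)) \<le> \<delta> / G * G"
      using G \<open>0 < G\<close> \<delta>(1) by (intro mult_mono) (auto simp: t_def)
    then show ?thesis
      using \<open>0 < G\<close> by simp
  qed
  have tB: "t * (B + 4 * \<tau> / \<delta>\<^sup>2) \<le> 1"
  proof -
    have "t * (B + 4 * \<tau> / \<delta>\<^sup>2) \<le> 1 / (B + 4 * \<tau> / \<delta>\<^sup>2) * (B + 4 * \<tau> / \<delta>\<^sup>2)"
      using denom by (intro mult_right_mono) (auto simp: t_def)
    then show ?thesis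
      using denom by simp
  qed
  have descent: "g (x k) \<bullet> (w k - x k) \<le> - (t / 2) * (norm (g (x k)))\<^sup>2" for k
    unfolding g_def
    by (rule model_minimizer_descent[OF S M _ _ w xK \<delta>(1) B])
       (use assms(1,3) \<open>0 < t\<close> tG tB in \<open>auto simp: g_def\<close>)

  \<comment> \<open>Up to the step length \<open>a0\<close> a trial point moves by at most \<open>\<delta>\<close>.\<close>
  define a0 where "a0 = \<delta> / (2 * R)"
  have "0 < a0"
    using \<delta>(1) \<open>0 < R\<close> by (simp add: a0_def)
  have inK: "x k + a *\<^sub>R (w k - x k) \<in> cube (1 - \<delta>)" if "0 \<le> a" "a \<le> a0" for a k
  proof -
    have "norm (a *\<^sub>R (w k - x k)) \<le> a0 * (2 * R)"
      using that V[of k] by (simp add: mult_mono)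
    also have "\<dots> = \<delta>"
      using \<open>0 < R\<close> by (simp add: a0_def)
    finally show ?thesis
      using cube_add[OF xK] by fastforce
  qed
  have g0: "(\<lambda>k. g (x k)) \<longlonglongrightarrow> 0"
  proof (rule exact_line_search_gradient_tendsto_zero[OF compact_cube _ cg[OF cube_Omega(2)] \<open>0 < a0\<close> _ inK _ V descent])
    show "GDERIV p y :> g y" if "y \<in> cube (1 - \<delta>)" for y
      using gder that cube_Omega by blast
    show "0 < t / 2"
      using \<open>0 < t\<close> by simp
    show "p (x (Suc k)) \<le> p (x k + a *\<^sub>R (w k - x k))" if "0 \<le> a" "a \<le> a0" for k a
      using search[OF that(1), of k] inK[OF that, of k] cube_Omega by blast
  qed

  have grad_p: "grad p y = g y" if "y \<in> Omega" for y
    using gder[OF that] by (rule grad_eqI)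
  have "x_inf \<in> Omega \<and> norm (grad p x_inf) = 0" if "x \<longlonglongrightarrow> x_inf" for x_inf
  proof -
    have mem: "x_inf \<in> cube (1 - 2 * \<delta>)"
      using that xK compact_imp_closed[OF compact_cube] closed_sequentially by blast
    have "(\<lambda>k. g (x k)) \<longlonglongrightarrow> g x_inf"
      by (rule continuous_on_tendsto_compose[OF cg[OF cube_Omega(1)] that mem]) (simp add: xK)
    then have "g x_inf = 0"
      using g0 LIMSEQ_unique by blast
    then show ?thesis
      using mem cube_Omega grad_p by auto
  qed
  moreover have "\<forall>\<^sub>F k in sequentially. \<exists>\<xi>\<in>Omega. norm (grad p \<xi>) = 0 \<and> dist (x k) \<xi> < \<epsilon>"
    if "0 < \<epsilon>" for \<epsilon>
    using eventually_close_to_zero_set[OF compact_cube cg[OF cube_Omega(1)] xK g0 that]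
    by (rule eventually_mono) (use cube_Omega grad_p in force)
  ultimately show ?thesis
    unfolding p_def by blast
qed

end
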